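(* Let $S\equiv(S,\cdot,I,\lambda,\rho)$ be a partial semigroup, let $i,j\in I$, let $a\in S_{ji}$ be sandwich-regular, and let $b\in V(a)$. Let $\phi:P^a\to W$ be the map $x\mapsto axa$. Then $$\mathbb E_a(S_{ij}^a)=\mathbb E_a(P^a)=\phi^{-1}\big(\mathbb E_b(W)\big).$$
   Context: A partial semigroup is a 5-tuple $(S,\cdot,I,\lambda,\rho)$ consisting of a class $S$, a partial binary operation $(x,y)\mapsto x\cdot y=xy$, a class $I$, and functions $\lambda,\rho:S\to I$ such that for all $x,y,z\in S$: (1) $xy$ is defined iff $x\rho=y\lambda$; (2) if $xy$ is defined then $(xy)\lambda=x\lambda$ and $(xy)\rho=y\rho$; (3) if $xy$ and $yz$ are defined then $(xy)z=x(yz)$; (4) for all $i,j\in I$, $S_{ij}=\{x\in S: x\lambda=i,\ x\rho=j\}$ is a set. For $x\in S$, $V(x)=\{y\in S: x=xyx,\ y=yxy\}$. $\operatorname{Reg}(S)=\{x\in S: x=xyx \text{ for some } y\in S\}$; likewise for semigroups. For $a\in S_{ji}$, the sandwich semigroup is $S_{ij}^a=(S_{ij},\star_a)$, where $x\star_a y=xay$. A regular element $a\in S_{ji}$ is sandwich-regular if $aS_{ij}a\subseteq\operatorname{Reg}(S)$. Assume $a$ is sandwich-regular and $b\in V(a)$ (so $b\in S_{ij}$). Write $P^a=\operatorname{Reg}(S_{ij}^a)$, which is a subsemigroup of $S_{ij}^a$, and $W=(aS_{ij}a,\circledast)$, where $u\circledast v=ubv$, i.e. $axa\circledast aya=axaya$;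 $W$ is a regular monoid with identity $a$ and underlying set $aP^aa$. For $X=S_{ij}^a$ or $X=P^a$, $\mathbb E_a(X)$ denotes the $\star_a$-subsemigroup generated by all $\star_a$-idempotents $\{x\in X: x=xax\}$. $\mathbb E_b(W)$ denotes the subsemigroup of $W$ generated by all idempotents $\{y\in W:y=yby\}$ of $W$. $\phi^{-1}$ denotes preimage. *)

theory Defs
  imports "HOL-Algebra.Congruence"
begin

text \<open>The partial operation is option-valued: \<open>pmult S x y = None\<close> means that
  \<open>xy\<close> is undefined. The requirement that every \<open>S\<^sub>i\<^sub>j\<close> be a set rather than a proper class
  holds automatically, because every collection of elements of a type is a HOL set.\<close>

record ('s, 'i) psgrp = "'s partial_object" +
  pmult :: "'s \<Rightarrow> 's \<Rightarrow> 's option"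
  objects :: "'i set"
  lam :: "'s \<Rightarrow> 'i"
  rho :: "'s \<Rightarrow> 'i"

locale partial_semigroup =
  fixes S :: "('s, 'i) psgrp"
  assumes lam_closed: "x \<in> carrier S \<Longrightarrow> lam S x \<in> objects S"
    and rho_closed: "x \<in> carrier S \<Longrightarrow> rho S x \<in> objects S"
    and pmult_closed:
      "\<lbrakk>x \<in> carrier S; y \<in> carrier S; pmult S x y = Some z\<rbrakk> \<Longrightarrow> z \<in> carrier S"
    and pmult_defined_iff:
      "\<lbrakk>x \<in> carrier S; y \<in> carrier S\<rbrakk> \<Longrightarrow> pmult S x y \<noteq> None \<longleftrightarrow> rho S x = lam S y"
    and lam_pmult:
      "\<lbrakk>x \<in> carrier S; y \<in> carrier S; pmult S x y = Some z\<rbrakk> \<Longrightarrow> lam S z = lam S x"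
    and rho_pmult:
      "\<lbrakk>x \<in> carrier S; y \<in> carrier S; pmult S x y = Some z\<rbrakk> \<Longrightarrow> rho S z = rho S y"
    and pmult_assoc:
      "\<lbrakk>x \<in> carrier S; y \<in> carrier S; z \<in> carrier S; pmult S x y = Some u; pmult S y z = Some v\<rbrakk>
        \<Longrightarrow> pmult S u z = pmult S x v"

definition pmult3 :: "('s, 'i) psgrp \<Rightarrow> 's \<Rightarrow> 's \<Rightarrow> 's \<Rightarrow> 's option" where
  "pmult3 S x y z = Option.bind (pmult S x y) (\<lambda>u. pmult S u z)"

definition homset :: "('s, 'i) psgrp \<Rightarrow> 'i \<Rightarrow> 'i \<Rightarrow> 's set" where
  "homset S i j = {x \<in> carrier S. lam S x = i \<and> rho S x = j}"

text \<open>In the next two definitions, an equation such as \<open>pmult3 S x y x = Some x\<close> asserts both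
  that \<open>xyx\<close> is defined and that \<open>x = xyx\<close>.\<close>

definition pinverses :: "('s, 'i) psgrp \<Rightarrow> 's \<Rightarrow> 's set" where
  "pinverses S x = {y \<in> carrier S. pmult3 S x y x = Some x \<and> pmult3 S y x y = Some y}"

definition pReg :: "('s, 'i) psgrp \<Rightarrow> 's set" where
  "pReg S = {x \<in> carrier S. \<exists>y \<in> carrier S. pmult3 S x y x = Some x}"

record 'a sgrp = "'a partial_object" +
  sgmult :: "'a \<Rightarrow> 'a \<Rightarrow> 'a"

definition sReg :: "'a sgrp \<Rightarrow> 'a set" where
  "sReg T = {x \<in> carrier T. \<exists>y \<in> carrier T. x = sgmult T (sgmult T x y) x}"

definition idempotents :: "'a sgrp \<Rightarrow> 'a set" where
  "idempotents T = {x \<in> carrier T. x = sgmult T x x}"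

inductive_set sg_generated :: "'a sgrp \<Rightarrow> 'a set \<Rightarrow> 'a set"
  for T :: "'a sgrp" and A :: "'a set" where
  incl: "x \<in> A \<Longrightarrow> x \<in> sg_generated T A"
| prod: "\<lbrakk>x \<in> sg_generated T A; y \<in> sg_generated T A\<rbrakk> \<Longrightarrow> sgmult T x y \<in> sg_generated T A"

definition idem_generated :: "'a sgrp \<Rightarrow> 'a set" where
  "idem_generated T = sg_generated T (idempotents T)"

text \<open>The following definitions are intended for \<open>a \<in> homset S j i\<close> and \<open>b \<in> homset S i j\<close>;
  all triple products under \<open>the\<close> are then defined.\<close>

definition aSa :: "('s, 'i) psgrp \<Rightarrow> 'i \<Rightarrow> 'i \<Rightarrow> 's \<Rightarrow> 's set" where
  "aSa S i j a = (\<lambda>x. the (pmult3 S a x a)) ` homset S i j"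

definition sandwich_regular :: "('s, 'i) psgrp \<Rightarrow> 'i \<Rightarrow> 'i \<Rightarrow> 's \<Rightarrow> bool" where
  "sandwich_regular S i j a \<longleftrightarrow>
     a \<in> homset S j i \<and> a \<in> pReg S \<and> aSa S i j a \<subseteq> pReg S"

definition sandwich :: "('s, 'i) psgrp \<Rightarrow> 'i \<Rightarrow> 'i \<Rightarrow> 's \<Rightarrow> 's sgrp" where
  "sandwich S i j a = \<lparr>carrier = homset S i j, sgmult = (\<lambda>x y. the (pmult3 S x a y))\<rparr>"

definition regP :: "('s, 'i) psgrp \<Rightarrow> 'i \<Rightarrow> 'i \<Rightarrow> 's \<Rightarrow> 's sgrp" where
  "regP S i j a = (sandwich S i j a)\<lparr>carrier := sReg (sandwich S i j a)\<rparr>"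

definition monW :: "('s, 'i) psgrp \<Rightarrow> 'i \<Rightarrow> 'i \<Rightarrow> 's \<Rightarrow> 's \<Rightarrow> 's sgrp" where
  "monW S i j a b = \<lparr>carrier = aSa S i j a, sgmult = (\<lambda>u v. the (pmult3 S u b v))\<rparr>"

definition phi :: "('s, 'i) psgrp \<Rightarrow> 's \<Rightarrow> 's \<Rightarrow> 's" where
  "phi S a x = the (pmult3 S a x a)"

end

theory Submission
  imports Defs
begin

text \<open>The \<open>\<star>\<^sub>a\<close>-idempotents of \<open>S\<^sub>i\<^sub>j\<close> are regular, which gives the first equality; and \<open>\<phi>\<close> is a
  homomorphism because \<open>aba = a\<close>. For the remaining inclusion, let \<open>x \<in> P\<^sup>a\<close> have
  \<open>axa = w \<in> E\<^sub>b(W)\<close>. The map \<open>w \<mapsto> bwb\<close> is a homomorphism from \<open>W\<close> to \<open>S\<^sub>i\<^sub>j\<^sup>a\<close>, so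
  \<open>bwb \<in> E\<^sub>a(S\<^sub>i\<^sub>j\<^sup>a)\<close>. If \<open>x = xayax\<close>, then \<open>x = (xay) w (yax)\<close> and
  \<open>w = abwba\<close>, which writes \<open>x\<close> as the \<open>\<star>\<^sub>a\<close>-product of the idempotent \<open>xay\<close>, of \<open>bwb\<close>, and of
  the idempotent \<open>yax\<close>.\<close>

section \<open>Generated subsemigroups and their images\<close>

text \<open>The carrier never enters the closure, so restricting a semigroup to a smaller carrier
  does not change what a given set generates.\<close>

lemma sg_generated_cong:
  assumes "sgmult T = sgmult T'"
  shows "sg_generated T A = sg_generated T' A"
proof -
  have "sg_generated T A \<subseteq> sg_generated T' A" if "sgmult T = sgmult T'" for T T' :: "'a sgrp"
  proof
    fix x assume "x \<in> sg_generated T A"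
    then show "x \<in> sg_generated T' A"
      by induction (auto simp: that intro: sg_generated.intros)
  qed
  then show ?thesis using assms by (metis subset_antisym)
qed

lemma sg_generated_closed:
  assumes "x \<in> sg_generated T A" "A \<subseteq> B"
    and "\<And>x y. \<lbrakk>x \<in> B; y \<in> B\<rbrakk> \<Longrightarrow> sgmult T x y \<in> B"
  shows "x \<in> B"
  using assms by (induction) auto

text \<open>Homomorphisms send idempotents to idempotents and products to products. Carrier
  membership is carried through the induction because \<open>hom\<close> is assumed on the carrier
  only.\<close>

lemma idem_generated_hom:
  assumes x: "x \<in> idem_generated T"
    and closed: "\<And>x y. \<lbrakk>x \<in> carrier T; y \<in> carrier T\<rbrakk> \<Longrightarrow> sgmult T x y \<in> carrier T"
    and carr: "\<And>x. x \<in> carrier T \<Longrightarrow> f x \<in> carrier T'"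
    and hom: "\<And>x y. \<lbrakk>x \<in> carrier T; y \<in> carrier T\<rbrakk> \<Longrightarrow>
                f (sgmult T x y) = sgmult T' (f x) (f y)"
  shows "f x \<in> idem_generated T'"
proof -
  have "x \<in> {x \<in> carrier T. f x \<in> idem_generated T'}"
    using x unfolding idem_generated_def
  proof (rule sg_generated_closed)
    show "idempotents T \<subseteq> {x \<in> carrier T. f x \<in> sg_generated T' (idempotents T')}"
    proof
      fix e assume e: "e \<in> idempotents T"
      then have "e \<in> carrier T" and "f e = sgmult T' (f e) (f e)"
        using hom[of e e] by (auto simp: idempotents_def)
      then have "f e \<in> idempotents T'"
        using carr by (simp add: idempotents_def)
      then show "e \<in> {x \<in> carrier T. f x \<in> sg_generated T' (idempotents T')}"
        using \<open>e \<in> carrier T\<close> by (simp add: sg_generated.incl)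
    qed
  qed (auto simp: closed hom intro: sg_generated.prod)
  then show ?thesis by simp
qed

lemma idempotents_subset_sReg: "idempotents T \<subseteq> sReg T"
proof
  fix x assume "x \<in> idempotents T"
  then have "x \<in> carrier T" "sgmult T x x = x" by (auto simp: idempotents_def)
  then show "x \<in> sReg T" by (auto simp: sReg_def intro!: bexI[of _ x])
qed

section \<open>Composable products as a total operation\<close>

context partial_semigroup
begin

text \<open>Dropping the option type lets associativity act as a rewrite rule towards right-nested
  products; the value is meaningful only when the endpoints match.\<close>

definition mul :: "'s \<Rightarrow> 's \<Rightarrow> 's"  (infixr "\<cdot>" 70) where
  "x \<cdot> y = the (pmult S x y)"

lemma pmult_eq:
  assumes "x \<in> carrier S" "y \<in> carrier S" "rho S x = lam S y"
  shows "pmult S x y = Some (x \<cdot> y)"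
  using assms pmult_defined_iff by (auto simp: mul_def)

lemma mul_homset:
  assumes "x \<in> homset S p q" "y \<in> homset S q r"
  shows "x \<cdot> y \<in> homset S p r"
proof -
  have "pmult S x y = Some (x \<cdot> y)" using assms pmult_eq by (simp add: homset_def)
  then show ?thesis
    using assms pmult_closed lam_pmult rho_pmult unfolding homset_def by blast
qed

lemma mul_assoc:
  assumes "x \<in> homset S p q" "y \<in> homset S q r" "z \<in> homset S r s"
  shows "(x \<cdot> y) \<cdot> z = x \<cdot> y \<cdot> z"
proof -
  have "pmult S x y = Some (x \<cdot> y)" "pmult S y z = Some (y \<cdot> z)"
    using assms pmult_eq by (simp_all add: homset_def)
  then have "pmult S (x \<cdot> y) z = pmult S x (y \<cdot> z)"
    using assms pmult_assoc[of x y z] by (simp add: homset_def)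
  then show ?thesis by (simp add: mul_def)
qed

lemma pmult3_eq:
  assumes "x \<in> homset S p q" "y \<in> homset S q r" "z \<in> homset S r s"
  shows "pmult3 S x y z = Some (x \<cdot> y \<cdot> z)"
proof -
  have "pmult S x y = Some (x \<cdot> y)" using assms pmult_eq by (simp add: homset_def)
  moreover have "pmult S (x \<cdot> y) z = Some ((x \<cdot> y) \<cdot> z)"
    using mul_homset[OF assms(1,2)] assms(3) pmult_eq by (simp add: homset_def)
  ultimately show ?thesis by (simp add: pmult3_def mul_assoc[OF assms])
qed

text \<open>A product can be defined only if the endpoints of its factors match, so the equations
  behind inverses and regularity also determine hom-sets.\<close>

lemma pmult3_SomeD:
  assumes "x \<in> carrier S" "y \<in> carrier S" "z \<in> carrier S" "pmult3 S x y z = Some w"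
  shows "rho S x = lam S y" "rho S y = lam S z" "x \<cdot> y \<cdot> z = w"
proof -
  obtain u where u: "pmult S x y = Some u" "pmult S u z = Some w"
    using assms(4) by (auto simp: pmult3_def bind_eq_Some_conv)
  show xy: "rho S x = lam S y" using u(1) pmult_defined_iff assms(1,2) by force
  have "u \<in> carrier S" "rho S u = rho S y"
    using u(1) pmult_closed rho_pmult assms(1,2) by blast+
  then show yz: "rho S y = lam S z" using u(2) pmult_defined_iff assms(3) by force
  show "x \<cdot> y \<cdot> z = w" using assms pmult3_eq[of x "lam S x" "rho S x" y "rho S y" z "rho S z"] xy yz
    by (simp add: homset_def)
qed

end

section \<open>The elements \<open>a\<close> and \<open>b\<close>\<close>

locale sandwich_regular_inverse = partial_semigroup +
  fixes i j a b
  assumes sreg: "sandwich_regular S i j a"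
    and inv: "b \<in> pinverses S a"
begin

lemma a_typed: "a \<in> homset S j i"
  using sreg by (simp add: sandwich_regular_def)

lemma b_typed: "b \<in> homset S i j"
proof -
  have "a \<in> carrier S" "lam S a = j" "rho S a = i"
    using a_typed by (auto simp: homset_def)
  then show ?thesis
    using inv pmult3_SomeD[of a b a] by (auto simp: pinverses_def homset_def)
qed

lemma aba: "a \<cdot> b \<cdot> a = a" and bab: "b \<cdot> a \<cdot> b = b"
  using inv a_typed b_typed pmult3_SomeD(3) by (auto simp: pinverses_def homset_def)

text \<open>Without the endpoints fixed, the simplifier could not discharge the typing conditions.\<close>

lemmas typed = a_typed b_typed
  mul_homset[of _ i i _ i] mul_homset[of _ i i _ j] mul_homset[of _ i j _ i] mul_homset[of _ i j _ j]
  mul_homset[of _ j i _ i] mul_homset[of _ j i _ j] mul_homset[of _ j j _ i] mul_homset[of _ j j _ j]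

lemmas assoc =
  mul_assoc[of _ i i _ i _ i] mul_assoc[of _ i i _ i _ j]
  mul_assoc[of _ i i _ j _ i] mul_assoc[of _ i i _ j _ j]
  mul_assoc[of _ i j _ i _ i] mul_assoc[of _ i j _ i _ j]
  mul_assoc[of _ i j _ j _ i] mul_assoc[of _ i j _ j _ j]
  mul_assoc[of _ j i _ i _ i] mul_assoc[of _ j i _ i _ j]
  mul_assoc[of _ j i _ j _ i] mul_assoc[of _ j i _ j _ j]
  mul_assoc[of _ j j _ i _ i] mul_assoc[of _ j j _ i _ j]
  mul_assoc[of _ j j _ j _ i] mul_assoc[of _ j j _ j _ j]

text \<open>In a right-nested product \<open>a \<cdot> b \<cdot> a\<close> is no longer a subterm
  once a factor follows it; this form of \<open>aba\<close> still matches there.\<close>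

lemma aba_mul:
  assumes "x \<in> homset S i k"
  shows "a \<cdot> b \<cdot> a \<cdot> x = a \<cdot> x"
proof -
  have "a \<cdot> b \<cdot> a \<cdot> x = a \<cdot> (b \<cdot> a) \<cdot> x"
    by (simp only: mul_assoc[OF b_typed a_typed assms])
  also have "\<dots> = (a \<cdot> b \<cdot> a) \<cdot> x"
    by (rule mul_assoc[symmetric, OF a_typed mul_homset[OF b_typed a_typed] assms])
  finally show ?thesis by (simp only: aba)
qed

section \<open>The semigroups \<open>S_ij^a\<close>, \<open>W\<close> and \<open>P^a\<close>\<close>

abbreviation "H \<equiv> homset S i j"

lemma phi_eq: "x \<in> H \<Longrightarrow> phi S a x = a \<cdot> x \<cdot> a"
  by (simp add: phi_def pmult3_eq[of _ j i _ j _ i] typed)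

lemma aSa_eq: "aSa S i j a = (\<lambda>x. a \<cdot> x \<cdot> a) ` H"
  by (auto simp: aSa_def pmult3_eq[of _ j i _ j _ i] typed intro!: image_cong)

lemma sgmult_sandwich:
  assumes "x \<in> H" "y \<in> H"
  shows "sgmult (sandwich S i j a) x y = x \<cdot> a \<cdot> y"
  using assms by (simp add: sandwich_def pmult3_eq[of _ i j _ i _ j] typed)

lemma carrier_sandwich: "carrier (sandwich S i j a) = H"
  by (simp add: sandwich_def)

lemma carrier_monW: "carrier (monW S i j a b) = aSa S i j a"
  by (simp add: monW_def)

lemma sandwich_closed: "\<lbrakk>x \<in> H; y \<in> H\<rbrakk> \<Longrightarrow> x \<cdot> a \<cdot> y \<in> H"
  by (simp add: typed)

lemma sgmult_monW:
  assumes "u \<in> aSa S i j a" "v \<in> aSa S i j a"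
  shows "sgmult (monW S i j a b) u v = u \<cdot> b \<cdot> v"
  using assms by (auto simp: aSa_eq monW_def pmult3_eq[of _ j i _ j _ i] typed)

text \<open>The inner \<open>aba\<close> collapses to \<open>a\<close>. This is the homomorphism
  property of \<open>phi\<close>, and it also shows that \<open>W\<close> is closed.\<close>

lemma sgmult_monW_phi:
  assumes "x \<in> H" "y \<in> H"
  shows "sgmult (monW S i j a b) (a \<cdot> x \<cdot> a) (a \<cdot> y \<cdot> a) = a \<cdot> (x \<cdot> a \<cdot> y) \<cdot> a"
proof -
  have "sgmult (monW S i j a b) (a \<cdot> x \<cdot> a) (a \<cdot> y \<cdot> a) = (a \<cdot> x \<cdot> a) \<cdot> b \<cdot> a \<cdot> y \<cdot> a"
    using assms by (intro sgmult_monW) (auto simp: aSa_eq)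
  also have "\<dots> = a \<cdot> (x \<cdot> a \<cdot> y) \<cdot> a"
    using assms by (simp add: typed assoc aba_mul[of _ i] aba_mul[of _ j])
  finally show ?thesis .
qed

lemma sReg_sandwich:
  "sReg (sandwich S i j a) = {x \<in> H. \<exists>y \<in> H. x \<cdot> a \<cdot> y \<cdot> a \<cdot> x = x}"
proof -
  have "sgmult (sandwich S i j a) (sgmult (sandwich S i j a) x y) x = x \<cdot> a \<cdot> y \<cdot> a \<cdot> x"
    if "x \<in> H" "y \<in> H" for x y
    using that
    by (simp add: sgmult_sandwich sandwich_closed) (simp add: typed assoc)
  then show ?thesis unfolding sReg_def carrier_sandwich
    by (intro Collect_cong conj_cong bex_cong refl) auto
qed

text \<open>Regularity of \<open>x\<close> and \<open>y\<close> gives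
  \<open>xay = (xau) w (vay)\<close> with \<open>w = axaya\<close>. Sandwich-regularity provides
  \<open>z\<close> with \<open>wzw = w\<close>, and this \<open>z\<close> witnesses the regularity
  of \<open>xay\<close>.\<close>

lemma sReg_closed:
  assumes "x \<in> sReg (sandwich S i j a)" "y \<in> sReg (sandwich S i j a)"
  shows "sgmult (sandwich S i j a) x y \<in> sReg (sandwich S i j a)"
proof -
  obtain u v where x: "x \<in> H" and u: "u \<in> H" "x \<cdot> a \<cdot> u \<cdot> a \<cdot> x = x"
    and y: "y \<in> H" and v: "v \<in> H" "y \<cdot> a \<cdot> v \<cdot> a \<cdot> y = y"
    using assms by (auto simp: sReg_sandwich)
  note H = x u(1) y v(1)
  define w where "w = a \<cdot> x \<cdot> a \<cdot> y \<cdot> a"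
  have w: "w \<in> homset S j i"
    using H by (simp add: w_def typed)
  have "w = a \<cdot> (x \<cdot> a \<cdot> y) \<cdot> a" using H by (simp add: w_def typed assoc)
  then have "w \<in> pReg S"
    using sreg sandwich_closed[OF x y] by (auto simp: sandwich_regular_def aSa_eq)
  then obtain z where "z \<in> carrier S" "pmult3 S w z w = Some w"
    by (auto simp: pReg_def)
  then have z: "z \<in> H" "w \<cdot> z \<cdot> w = w"
    using w pmult3_SomeD[of w z w] by (auto simp: homset_def)
  \<comment> \<open>Multiplying \<open>w\<close> by \<open>xau\<close> on the left removes its
    leading \<open>a\<close>; fact \<open>2\<close> removes the trailing \<open>a\<close> in the
    same way.\<close>
  have 1: "x \<cdot> a \<cdot> u \<cdot> w = x \<cdot> a \<cdot> y \<cdot> a"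
  proof -
    have "x \<cdot> a \<cdot> u \<cdot> w = (x \<cdot> a \<cdot> u \<cdot> a \<cdot> x) \<cdot> a \<cdot> y \<cdot> a"
      using H by (simp add: w_def typed assoc)
    then show ?thesis by (simp add: u)
  qed
  have 2: "w \<cdot> v \<cdot> a \<cdot> y = a \<cdot> x \<cdot> a \<cdot> y"
    using H by (simp add: w_def typed assoc v)
  have "x \<cdot> a \<cdot> y = x \<cdot> a \<cdot> y \<cdot> a \<cdot> v \<cdot> a \<cdot> y" by (simp add: v)
  also have "\<dots> = (x \<cdot> a \<cdot> y \<cdot> a) \<cdot> v \<cdot> a \<cdot> y" using H by (simp add: typed assoc)
  also have "\<dots> = (x \<cdot> a \<cdot> u \<cdot> w \<cdot> z \<cdot> w) \<cdot> v \<cdot> a \<cdot> y" by (simp add: 1 z)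
  also have "\<dots> = (x \<cdot> a \<cdot> u \<cdot> w) \<cdot> z \<cdot> w \<cdot> v \<cdot> a \<cdot> y"
    using H w z(1) by (simp add: typed assoc)
  also have "\<dots> = (x \<cdot> a \<cdot> y \<cdot> a) \<cdot> z \<cdot> a \<cdot> x \<cdot> a \<cdot> y" by (simp only: 1 2)
  also have "\<dots> = (x \<cdot> a \<cdot> y) \<cdot> a \<cdot> z \<cdot> a \<cdot> (x \<cdot> a \<cdot> y)"
    using H z(1) by (simp add: typed assoc)
  finally have "(x \<cdot> a \<cdot> y) \<cdot> a \<cdot> z \<cdot> a \<cdot> (x \<cdot> a \<cdot> y) = x \<cdot> a \<cdot> y" by simp
  then show ?thesis
    using x y z(1) by (auto simp: sReg_sandwich sgmult_sandwich sandwich_closed)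
qed

lemma carrier_regP: "carrier (regP S i j a) = sReg (sandwich S i j a)"
  by (simp add: regP_def)

lemma sgmult_regP: "sgmult (regP S i j a) = sgmult (sandwich S i j a)"
  by (simp add: regP_def)

section \<open>Idempotent-generated subsemigroups\<close>

lemma idem_generated_regP: "idem_generated (regP S i j a) = idem_generated (sandwich S i j a)"
proof -
  have "idempotents (regP S i j a) = idempotents (sandwich S i j a)"
    using idempotents_subset_sReg[of "sandwich S i j a"]
    by (auto simp: idempotents_def carrier_regP sgmult_regP sReg_def)
  then show ?thesis
    by (simp add: idem_generated_def sg_generated_cong[OF sgmult_regP])
qed

text \<open>Idempotents are regular and \<open>P^a\<close> is closed. The preimage under
  \<open>phi\<close> is taken within \<open>P^a\<close>, so its description requires this.\<close>

lemma idem_generated_subset_regP: "idem_generated (sandwich S i j a) \<subseteq> carrier (regP S i j a)"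
  unfolding idem_generated_def carrier_regP
  using sg_generated_closed[OF _ idempotents_subset_sReg sReg_closed] by blast

lemma phi_idem_generated:
  assumes "x \<in> idem_generated (sandwich S i j a)"
  shows "phi S a x \<in> idem_generated (monW S i j a b)"
  using assms
  by (rule idem_generated_hom)
    (auto simp: carrier_sandwich carrier_monW sgmult_sandwich sandwich_closed phi_eq
      sgmult_monW_phi aSa_eq)

text \<open>Since \<open>bab = b\<close>, the product \<open>(bub)a(bvb)\<close> equals
  \<open>b(ubv)b\<close>, so \<open>w \<mapsto> bwb\<close> is a homomorphism.\<close>

lemma bwb_idem_generated:
  assumes "w \<in> idem_generated (monW S i j a b)"
  shows "b \<cdot> w \<cdot> b \<in> idem_generated (sandwich S i j a)"
  using assms
proof (rule idem_generated_hom[where f = "\<lambda>w. b \<cdot> w \<cdot> b"], unfold carrier_monW carrier_sandwich)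
  have typed_aSa: "u \<in> homset S j i" if "u \<in> aSa S i j a" for u
    using that by (auto simp: aSa_eq typed)
  have in_H: "b \<cdot> u \<cdot> b \<in> H" if "u \<in> aSa S i j a" for u
    using typed_aSa[OF that] by (simp add: typed)
  then show "\<And>u. u \<in> aSa S i j a \<Longrightarrow> b \<cdot> u \<cdot> b \<in> H" .
  show "sgmult (monW S i j a b) u v \<in> aSa S i j a"
    if "u \<in> aSa S i j a" "v \<in> aSa S i j a" for u v
    using that sandwich_closed by (auto simp: aSa_eq sgmult_monW_phi)
  show "b \<cdot> sgmult (monW S i j a b) u v \<cdot> b
      = sgmult (sandwich S i j a) (b \<cdot> u \<cdot> b) (b \<cdot> v \<cdot> b)"
    if u: "u \<in> aSa S i j a" and v: "v \<in> aSa S i j a" for u v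
  proof -
    have "sgmult (sandwich S i j a) (b \<cdot> u \<cdot> b) (b \<cdot> v \<cdot> b) = (b \<cdot> u \<cdot> b) \<cdot> a \<cdot> b \<cdot> v \<cdot> b"
      by (simp add: sgmult_sandwich in_H u v)
    also have "\<dots> = b \<cdot> u \<cdot> (b \<cdot> a \<cdot> b) \<cdot> v \<cdot> b"
      using typed_aSa[OF u] typed_aSa[OF v] by (simp add: typed assoc)
    also have "\<dots> = b \<cdot> (u \<cdot> b \<cdot> v) \<cdot> b"
      unfolding bab using typed_aSa[OF u] typed_aSa[OF v] by (simp add: typed assoc)
    finally show ?thesis by (simp add: sgmult_monW u v)
  qed
qed

lemma regular_idem_generated:
  assumes x: "x \<in> sReg (sandwich S i j a)"
    and w: "phi S a x \<in> idem_generated (monW S i j a b)"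
  shows "x \<in> idem_generated (sandwich S i j a)"
proof -
  let ?T = "sandwich S i j a"
  obtain u where xH: "x \<in> H" and u: "u \<in> H" "x \<cdot> a \<cdot> u \<cdot> a \<cdot> x = x"
    using x by (auto simp: sReg_sandwich)
  note H = xH u(1)
  \<comment> \<open>The regularity equation in a form that still matches when further factors
    follow, as in \<open>e \<cdot> a \<cdot> e\<close>.\<close>
  have xux: "x \<cdot> a \<cdot> u \<cdot> a \<cdot> x \<cdot> z = x \<cdot> z" if "z \<in> homset S j j" for z
  proof -
    have "(x \<cdot> a \<cdot> u \<cdot> a \<cdot> x) \<cdot> z = x \<cdot> a \<cdot> u \<cdot> a \<cdot> x \<cdot> z"
      using H that by (simp add: typed assoc)
    then show ?thesis by (simp add: u)
  qed
  have idem: "e \<in> idem_generated ?T" if "e \<in> H" "e \<cdot> a \<cdot> e = e" for e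
    using that unfolding idem_generated_def
    by (intro sg_generated.incl) (simp add: idempotents_def carrier_sandwich sgmult_sandwich)
  \<comment> \<open>The operation \<open>sgmult\<close> can be rewritten as
    \<open>p \<cdot> a \<cdot> q\<close> once both factors are known to lie in \<open>H\<close>;
    membership in \<open>P^a\<close> ensures this.\<close>
  have prod: "p \<cdot> a \<cdot> q \<in> idem_generated ?T"
    if "p \<in> idem_generated ?T" "q \<in> idem_generated ?T" for p q
  proof -
    have "p \<in> H" "q \<in> H"
      using that idem_generated_subset_regP by (auto simp: carrier_regP sReg_sandwich)
    then show ?thesis
      using that sg_generated.prod sgmult_sandwich unfolding idem_generated_def by metis
  qed
  define e where "e = x \<cdot> a \<cdot> u"
  define f where "f = u \<cdot> a \<cdot> x"
  define c where "c = b \<cdot> (a \<cdot> x \<cdot> a) \<cdot> b"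
  have "e \<in> idem_generated ?T"
    by (rule idem) (use H in \<open>simp_all add: e_def typed assoc xux u\<close>)
  moreover have "f \<in> idem_generated ?T"
    by (rule idem) (use H in \<open>simp_all add: f_def typed assoc u\<close>)
  moreover have "c \<in> idem_generated ?T"
    using bwb_idem_generated w unfolding c_def phi_eq[OF xH] by blast
  ultimately have "e \<cdot> a \<cdot> c \<cdot> a \<cdot> f \<in> idem_generated ?T" by (intro prod)
  \<comment> \<open>Two uses of \<open>aba = a\<close> reduce \<open>aca\<close> to
    \<open>axa\<close>; the remaining \<open>xauaxauax\<close> reduces to \<open>x\<close> by
    applying regularity twice.\<close>
  moreover have "e \<cdot> a \<cdot> c \<cdot> a \<cdot> f = x"
    using H by (simp add: e_def f_def c_def typed assoc aba_mul[of _ i] aba_mul[of _ j] xux u)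
  ultimately show ?thesis by simp
qed

end

theorem theorem2p17:
  fixes S :: "('s, 'i) psgrp" and i j :: 'i and a b :: 's
  assumes "partial_semigroup S"
    and "i \<in> objects S" and "j \<in> objects S"
    and "a \<in> homset S j i"
    and "sandwich_regular S i j a"
    and "b \<in> pinverses S a"
  shows "idem_generated (sandwich S i j a) = idem_generated (regP S i j a)
    \<and> idem_generated (regP S i j a)
        = {x \<in> carrier (regP S i j a). phi S a x \<in> idem_generated (monW S i j a b)}"
proof -
  interpret sandwich_regular_inverse S i j a b
    using assms by (simp add: sandwich_regular_inverse_def sandwich_regular_inverse_axioms_def)
  show ?thesis
    using idem_generated_regP idem_generated_subset_regP phi_idem_generated regular_idem_generated
    by (auto simp: carrier_regP)
qed

end
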